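(* Let $k,s\in\mathbb N$ and $s>k$. Then $$\operatorname{Helly}_{\ell_1^{\binom{s}{k}}}(k)\ge\frac{s-k}{s+k}.$$ In particular, $$\operatorname{Helly}_{\ell_1^{\binom{2k}{k}}}(k)\ge\frac13.$$
   Context: $\ell_1^N$ is $\mathbb R^N$ with the $\ell_1$-norm. For a Banach space $X$ with closed unit ball $\mathbf B_X$, $\operatorname{Helly}_X(k)$ is the infimum of all $\alpha>0$ such that: for every finite family $\mathcal F$ of convex subsets of $\mathbf B_X$, if every subfamily of $\mathcal F$ of size at most $k$ has non-empty intersection, then there is $x\in X$ with $\operatorname{dist}(x,C)\le\alpha$ for every $C\in\mathcal F$. *)

theory Defs
  imports "HOL-Analysis.Analysis"
begin

text \<open>
  For finite \<open>'n\<close>, the type \<open>'n l1\<close> is the Banach space $\ell_1^N$ with $N$ the cardinality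
  of \<open>'n\<close>. The type \<open>real ^ 'n\<close> cannot be used, since its norm is the Euclidean one.
\<close>

typedef 'n l1 = "UNIV :: ('n \<Rightarrow> real) set"
  morphisms l1_nth Abs_l1 ..

lemma l1_nth_Abs [simp]: "l1_nth (Abs_l1 f) = f"
  by (simp add: Abs_l1_inverse)

lemma l1_eq_iff: "x = y \<longleftrightarrow> (\<forall>i. l1_nth x i = l1_nth y i)"
  by (metis ext l1_nth_inject)

instantiation l1 :: (finite) real_vector
begin

definition zero_l1 :: "'a l1" where
  "0 = Abs_l1 (\<lambda>_. 0)"

definition plus_l1 :: "'a l1 \<Rightarrow> 'a l1 \<Rightarrow> 'a l1" where
  "x + y = Abs_l1 (\<lambda>i. l1_nth x i + l1_nth y i)"

definition minus_l1 :: "'a l1 \<Rightarrow> 'a l1 \<Rightarrow> 'a l1" where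
  "x - y = Abs_l1 (\<lambda>i. l1_nth x i - l1_nth y i)"

definition uminus_l1 :: "'a l1 \<Rightarrow> 'a l1" where
  "- x = Abs_l1 (\<lambda>i. - l1_nth x i)"

definition scaleR_l1 :: "real \<Rightarrow> 'a l1 \<Rightarrow> 'a l1" where
  "r *\<^sub>R x = Abs_l1 (\<lambda>i. r * l1_nth x i)"

instance
  by standard (simp_all add: l1_eq_iff zero_l1_def plus_l1_def minus_l1_def uminus_l1_def
    scaleR_l1_def algebra_simps)

end

lemma l1_nth_simps [simp]:
  "l1_nth 0 i = 0"
  "l1_nth (x + y) i = l1_nth x i + l1_nth y i"
  "l1_nth (x - y) i = l1_nth x i - l1_nth y i"
  "l1_nth (- x) i = - l1_nth x i"
  "l1_nth (r *\<^sub>R x) i = r * l1_nth x i"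
  for x y :: "'n::finite l1"
  by (simp_all add: zero_l1_def plus_l1_def minus_l1_def uminus_l1_def scaleR_l1_def)

instantiation l1 :: (finite) real_normed_vector
begin

definition norm_l1 :: "'a l1 \<Rightarrow> real" where
  "norm x = (\<Sum>i\<in>UNIV. \<bar>l1_nth x i\<bar>)"

definition sgn_l1 :: "'a l1 \<Rightarrow> 'a l1" where
  "sgn (x :: 'a l1) = inverse (norm x) *\<^sub>R x"

definition dist_l1 :: "'a l1 \<Rightarrow> 'a l1 \<Rightarrow> real" where
  "dist (x :: 'a l1) y = norm (x - y)"

definition uniformity_l1 :: "('a l1 \<times> 'a l1) filter" where
  "(uniformity :: ('a l1 \<times> 'a l1) filter) = (INF e\<in>{0<..}. principal {(x, y). dist x y < e})"

definition open_l1 :: "'a l1 set \<Rightarrow> bool" where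
  "open (U :: 'a l1 set) \<longleftrightarrow> (\<forall>x\<in>U. \<forall>\<^sub>F (x', y) in uniformity. x' = x \<longrightarrow> y \<in> U)"

instance
proof
  fix x y :: "'a l1" and a :: real
  show "norm x = 0 \<longleftrightarrow> x = 0"
    by (simp add: norm_l1_def l1_eq_iff sum_nonneg_eq_0_iff)
  show "norm (x + y) \<le> norm x + norm y"
    by (simp add: norm_l1_def sum.distrib [symmetric] sum_mono abs_triangle_ineq)
  show "norm (a *\<^sub>R x) = \<bar>a\<bar> * norm x"
    by (simp add: norm_l1_def abs_mult sum_distrib_left)
qed (simp_all add: sgn_l1_def dist_l1_def uniformity_l1_def open_l1_def)

end

lemma abs_l1_nth_le_norm: "\<bar>l1_nth x i\<bar> \<le> norm x" for x :: "'n::finite l1"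
  unfolding norm_l1_def by (rule member_le_sum) auto

instance l1 :: (finite) banach
proof
  fix X :: "nat \<Rightarrow> 'a l1"
  assume X: "Cauchy X"
  have "Cauchy (\<lambda>m. l1_nth (X m) i)" for i
  proof (rule metric_CauchyI)
    fix e :: real
    assume "0 < e"
    then obtain M where M: "\<And>m n. m \<ge> M \<Longrightarrow> n \<ge> M \<Longrightarrow> dist (X m) (X n) < e"
      using X metric_CauchyD by blast
    have "dist (l1_nth (X m) i) (l1_nth (X n) i) < e" if "m \<ge> M" "n \<ge> M" for m n
      using M [OF that] abs_l1_nth_le_norm [of "X m - X n" i] by (simp add: dist_norm)
    then show "\<exists>M. \<forall>m\<ge>M. \<forall>n\<ge>M. dist (l1_nth (X m) i) (l1_nth (X n) i) < e"
      by blast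
  qed
  then have lim: "(\<lambda>m. l1_nth (X m) i) \<longlonglongrightarrow> lim (\<lambda>m. l1_nth (X m) i)" for i
    by (simp add: Cauchy_convergent_iff convergent_LIMSEQ_iff)
  define L where "L = Abs_l1 (\<lambda>i. lim (\<lambda>m. l1_nth (X m) i))"
  have "(\<lambda>m. \<Sum>i\<in>UNIV. \<bar>l1_nth (X m) i - l1_nth L i\<bar>) \<longlonglongrightarrow> (\<Sum>i\<in>UNIV. \<bar>l1_nth L i - l1_nth L i\<bar>)"
    using lim by (intro tendsto_intros) (simp add: L_def)
  then have "(\<lambda>m. norm (X m - L)) \<longlonglongrightarrow> 0"
    by (simp add: norm_l1_def)
  then have "X \<longlonglongrightarrow> L"
    by (simp add: LIM_zero_iff tendsto_norm_zero_iff)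
  then show "convergent X"
    by (auto simp: convergent_def)
qed

text \<open>
  The library sets \<^term>\<open>infdist x {} = 0\<close>. This is harmless here: for \<open>k \<ge> 1\<close> the hypothesis on
  the subfamilies forces every member of \<open>F\<close> to be non-empty, and for \<open>k = 0\<close> it merely means
  that empty members are disregarded. Hence \<open>\<alpha> = 1\<close> is always admissible (take \<open>x = 0\<close>), and
  the infimum is over a non-empty set of reals bounded below by \<open>0\<close>.
  Subfamilies may be empty, with \<^term>\<open>\<Inter>{} = UNIV\<close>.
\<close>

definition helly :: "'a::banach itself \<Rightarrow> nat \<Rightarrow> real" where
  "helly (X :: 'a itself) k = Inf {\<alpha>. \<alpha> > 0 \<and>
     (\<forall>F :: 'a set set.
        finite F \<and> (\<forall>C\<in>F. convex C \<and> C \<subseteq> cball 0 1) \<and>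
        (\<forall>G\<subseteq>F. card G \<le> k \<longrightarrow> \<Inter>G \<noteq> {}) \<longrightarrow>
        (\<exists>x. \<forall>C\<in>F. infdist x C \<le> \<alpha>))}"

end

(*
  Let f_i, i in J, be functionals of norm at most 1 whose sum is 0, and let C_i be the part of the
  unit ball where f_i >= a. Since dist(x, C_i) >= a - f_i(x), the average over i of the distances
  from x to the C_i is at least a, whatever x is. Now index the coordinates by the k-subsets A of
  {0,...,s-1}, and let f_i have coefficient (s-k)/s at the A containing i and -k/s at the others.
  Each A contributes k(s-k)/s - (s-k)k/s = 0 to the sum of the f_i, and with a = (s-k)/s the unit
  vector e_A lies in C_i for every i in A, so any k of the C_i intersect. This yields the
  bound (s-k)/s, which is stronger than (s-k)/(s+k).
*)
theory Submission
  imports Defs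
begin

definition l1_pairing :: "('n::finite \<Rightarrow> real) \<Rightarrow> 'n l1 \<Rightarrow> real" where
  "l1_pairing w y = (\<Sum>j\<in>UNIV. w j * l1_nth y j)"

definition l1_unit :: "'n::finite \<Rightarrow> 'n l1" where
  "l1_unit j = Abs_l1 (\<lambda>i. if i = j then 1 else 0)"

lemma linear_l1_pairing: "linear (l1_pairing w)"
  by (rule linearI) (simp_all add: l1_pairing_def algebra_simps sum.distrib sum_distrib_left)

text \<open>The norm dual to the l1 norm is the sup norm, so coefficients of modulus at most 1 give
  a functional of norm at most 1.\<close>

lemma l1_pairing_le_norm:
  assumes "\<And>j. \<bar>w j\<bar> \<le> 1"
  shows "l1_pairing w y \<le> norm y"
  unfolding l1_pairing_def norm_l1_def
proof (rule sum_mono)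
  fix j
  have "w j * l1_nth y j \<le> \<bar>w j\<bar> * \<bar>l1_nth y j\<bar>"
    by (metis abs_ge_self abs_mult)
  also have "\<dots> \<le> \<bar>l1_nth y j\<bar>"
    using mult_right_mono [OF assms [of j], of "\<bar>l1_nth y j\<bar>"] by simp
  finally show "w j * l1_nth y j \<le> \<bar>l1_nth y j\<bar>" .
qed

lemma sum_l1_pairing:
  "(\<Sum>i\<in>J. l1_pairing (w i) x) = (\<Sum>j\<in>UNIV. (\<Sum>i\<in>J. w i j) * l1_nth x j)"
  unfolding l1_pairing_def sum_distrib_right by (rule sum.swap)

lemma l1_pairing_unit [simp]: "l1_pairing w (l1_unit j) = w j"
  by (simp add: l1_pairing_def l1_unit_def if_distrib [of "(*) _"] cong: if_cong)

lemma norm_l1_unit [simp]: "norm (l1_unit j) = 1"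
  by (simp add: norm_l1_def l1_unit_def if_distrib cong: if_cong)

lemma convex_linear_ge:
  fixes f :: "'a::real_vector \<Rightarrow> real"
  assumes "linear f"
  shows "convex {y. a \<le> f y}"
  using convex_linear_vimage [OF assms, of "{a..}"] by (simp add: vimage_def)

text \<open>A lower bound on \<open>Inf\<close> requires some admissible \<alpha> to exist; \<alpha>
  = 1 is one, with \<open>0\<close> as the point, since all members lie in the unit ball.\<close>

lemma helly_geI:
  assumes "\<And>\<alpha>. \<alpha> > 0 \<Longrightarrow> (\<And>F :: 'a::banach set set. finite F \<Longrightarrow>
      (\<And>C. C \<in> F \<Longrightarrow> convex C \<and> C \<subseteq> cball 0 1) \<Longrightarrow>
      (\<And>G. G \<subseteq> F \<Longrightarrow> card G \<le> k \<Longrightarrow> \<Inter>G \<noteq> {}) \<Longrightarrow> \<exists>x. \<forall>C\<in>F. infdist x C \<le> \<alpha>) \<Longrightarrow> a \<le> \<alpha>"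
  shows "a \<le> helly TYPE('a) k"
  unfolding helly_def
proof (rule cInf_greatest)
  have "infdist 0 C \<le> 1" if "C \<subseteq> cball (0 :: 'a) 1" for C
  proof (cases "C = {}")
    case False
    then obtain y where "y \<in> C" by blast
    with that show ?thesis
      by (intro infdist_le2 [of y]) auto
  qed (simp add: infdist_def)
  then have "(1 :: real) > 0 \<and> (\<forall>F :: 'a set set.
        finite F \<and> (\<forall>C\<in>F. convex C \<and> C \<subseteq> cball 0 1) \<and>
        (\<forall>G\<subseteq>F. card G \<le> k \<longrightarrow> \<Inter>G \<noteq> {}) \<longrightarrow> (\<exists>x. \<forall>C\<in>F. infdist x C \<le> 1))"
    by (intro conjI allI impI exI [of _ 0] ballI) simp_all
  then show "{\<alpha>. \<alpha> > 0 \<and> (\<forall>F :: 'a set set.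
        finite F \<and> (\<forall>C\<in>F. convex C \<and> C \<subseteq> cball 0 1) \<and>
        (\<forall>G\<subseteq>F. card G \<le> k \<longrightarrow> \<Inter>G \<noteq> {}) \<longrightarrow> (\<exists>x. \<forall>C\<in>F. infdist x C \<le> \<alpha>))} \<noteq> {}"
    by blast
next
  fix \<alpha>
  assume "\<alpha> \<in> {\<alpha>. \<alpha> > 0 \<and> (\<forall>F :: 'a set set.
        finite F \<and> (\<forall>C\<in>F. convex C \<and> C \<subseteq> cball 0 1) \<and>
        (\<forall>G\<subseteq>F. card G \<le> k \<longrightarrow> \<Inter>G \<noteq> {}) \<longrightarrow> (\<exists>x. \<forall>C\<in>F. infdist x C \<le> \<alpha>))}"
  then show "a \<le> \<alpha>"
    by (intro assms) simp_all
qed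

text \<open>This is the averaging argument for arbitrary coefficients. The assumption
  \<open>nonempty\<close> stands apart from \<open>meet\<close>, which speaks only of
  \<open>I = {}\<close> when \<open>k = 0\<close>: an empty \<open>C i\<close> would have
  \<open>infdist x (C i) = 0\<close> and break the distance estimate.\<close>

lemma helly_l1_ge_balanced:
  fixes w :: "'i \<Rightarrow> 'n::finite \<Rightarrow> real"
  assumes J: "finite J" "J \<noteq> {}"
    and w_le: "\<And>i j. i \<in> J \<Longrightarrow> \<bar>w i j\<bar> \<le> 1"
    and w_sum: "\<And>j. (\<Sum>i\<in>J. w i j) = 0"
    and nonempty: "\<And>i. i \<in> J \<Longrightarrow> \<exists>v\<in>cball 0 1. a \<le> l1_pairing (w i) v"
    and meet: "\<And>I. I \<subseteq> J \<Longrightarrow> card I \<le> k \<Longrightarrow> \<exists>v\<in>cball 0 1. \<forall>i\<in>I. a \<le> l1_pairing (w i) v"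
  shows "a \<le> helly TYPE('n l1) k"
proof (rule helly_geI)
  define C where "C i = cball 0 1 \<inter> {y. a \<le> l1_pairing (w i) y}" for i
  fix \<alpha> :: real
  assume hyp: "\<And>F :: 'n l1 set set. finite F \<Longrightarrow>
      (\<And>C. C \<in> F \<Longrightarrow> convex C \<and> C \<subseteq> cball 0 1) \<Longrightarrow>
      (\<And>G. G \<subseteq> F \<Longrightarrow> card G \<le> k \<Longrightarrow> \<Inter>G \<noteq> {}) \<Longrightarrow> \<exists>x. \<forall>C\<in>F. infdist x C \<le> \<alpha>"
  have "\<exists>x. \<forall>D\<in>C ` J. infdist x D \<le> \<alpha>"
  proof (rule hyp)
    show "finite (C ` J)" using J by simp
    show "convex D \<and> D \<subseteq> cball 0 1" if "D \<in> C ` J" for D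
      using that by (auto simp: C_def intro!: convex_Int convex_linear_ge linear_l1_pairing)
    show "\<Inter>G \<noteq> {}" if "G \<subseteq> C ` J" "card G \<le> k" for G
    proof -
      \<comment> \<open>Different indices may give the same set, so one index is chosen for each
        member of \<open>G\<close>; then \<open>card I = card G\<close> and \<open>meet\<close>
        applies.\<close>
      obtain I where I: "I \<subseteq> J" "inj_on C I" "G = C ` I"
        using \<open>G \<subseteq> C ` J\<close> by (auto simp: subset_image_inj)
      then have "card I \<le> k"
        using \<open>card G \<le> k\<close> by (simp add: card_image)
      with meet I(1) obtain v where "v \<in> cball 0 1" "\<forall>i\<in>I. a \<le> l1_pairing (w i) v"
        by blast
      then have "v \<in> \<Inter>G"
        unfolding I(3) C_def by simp
      then show ?thesis by blast
    qed
  qed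
  then obtain x where x: "\<And>i. i \<in> J \<Longrightarrow> infdist x (C i) \<le> \<alpha>"
    by blast
  have "a - l1_pairing (w i) x \<le> \<alpha>" if "i \<in> J" for i
  proof -
    have ne: "C i \<noteq> {}"
      using nonempty [OF that] by (auto simp: C_def)
    have "a - l1_pairing (w i) x \<le> dist x y" if "y \<in> C i" for y
    proof -
      have "a - l1_pairing (w i) x \<le> l1_pairing (w i) (y - x)"
        using that by (simp add: C_def linear_diff [OF linear_l1_pairing])
      also have "\<dots> \<le> norm (y - x)"
        using w_le [OF \<open>i \<in> J\<close>] by (rule l1_pairing_le_norm)
      finally show ?thesis
        by (simp add: dist_norm norm_minus_commute)
    qed
    then have "a - l1_pairing (w i) x \<le> infdist x (C i)"
      using ne by (auto simp: infdist_def intro: cINF_greatest)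
    with x [OF that] show ?thesis by simp
  qed
  then have "(\<Sum>i\<in>J. a - l1_pairing (w i) x) \<le> (\<Sum>i\<in>J. \<alpha>)"
    by (rule sum_mono)
  \<comment> \<open>By \<open>w_sum\<close> the functionals add up to zero, so \<open>x\<close>
    drops out.\<close>
  then have "real (card J) * a \<le> real (card J) * \<alpha>"
    by (simp add: sum_subtractf sum_l1_pairing w_sum)
  then show "a \<le> \<alpha>"
    using J by (simp add: card_gt_0_iff)
qed

text \<open>For \<open>k = 0\<close> the intersection condition concerns only the empty subfamily,
  so two opposite faces of the unit ball may be used: those where the coordinate sum is 1 and
  -1.\<close>

lemma helly_l1_0_ge: "1 \<le> helly TYPE('n::finite l1) 0"
proof (rule helly_l1_ge_balanced [where J = UNIV and w = "\<lambda>b _. if b then 1 else - 1"])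
  fix b :: bool
  \<comment> \<open>Any coordinate would do; \<open>undefined\<close> just picks one.\<close>
  have "l1_pairing (\<lambda>_ :: 'n. if b then 1 else - 1)
      ((if b then 1 else - 1) *\<^sub>R l1_unit undefined) = 1"
    by (simp add: linear_cmul [OF linear_l1_pairing])
  then show "\<exists>v\<in>cball 0 1. 1 \<le> l1_pairing (\<lambda>_ :: 'n. if b then 1 else - 1) v"
    by (intro bexI [of _ "(if b then 1 else - 1) *\<^sub>R l1_unit undefined"]) auto
next
  fix I :: "bool set"
  assume "card I \<le> 0"
  then have "I = {}" by simp
  then show "\<exists>v\<in>cball 0 1. \<forall>b\<in>I. 1 \<le> l1_pairing (\<lambda>_ :: 'n. if b then 1 else - 1) v"
    by (intro bexI [of _ 0]) auto
qed (auto simp: UNIV_bool)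

lemma helly_l1_binomial_ge:
  assumes "k < s" and card_n: "CARD('n::finite) = s choose k"
  shows "(real s - real k) / real s \<le> helly TYPE('n l1) k"
proof (cases "k = 0")
  \<comment> \<open>The sets built below would be empty here: no \<open>i\<close> lies in the only
    0-subset, so all coefficients vanish while \<open>a = 1\<close>.\<close>
  case True
  then show ?thesis using helly_l1_0_ge \<open>k < s\<close> by simp
next
  case False
  define a where "a = (real s - real k) / real s"
  let ?\<A> = "{A. A \<subseteq> {..<s} \<and> card A = k}"
  have "card ?\<A> = CARD('n)"
    by (simp add: n_subsets card_n)
  then obtain B :: "'n \<Rightarrow> nat set" where B: "bij_betw B UNIV ?\<A>"
    using finite_same_card_bij [of "UNIV :: 'n set" ?\<A>] by auto
  then have B_subset: "B j \<subseteq> {..<s}" and B_card: "card (B j) = k" for j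
    using bij_betwE by blast+
  \<comment> \<open>For each \<open>j\<close> this is the indicator of \<open>B j\<close> minus its
    mean \<open>k / s\<close> over \<open>{..<s}\<close>, hence the zero sum; \<open>a\<close> is
    \<open>1 - k / s\<close>.\<close>
  define w where "w i j = (if i \<in> B j then a else - (real k / real s))" for i j
  have meet: "\<exists>v\<in>cball 0 1. \<forall>i\<in>I. a \<le> l1_pairing (w i) v"
    if I: "I \<subseteq> {..<s}" "card I \<le> k" for I
  proof -
    \<comment> \<open>Enlarging \<open>I\<close> to exactly \<open>k\<close> elements makes it the
      label of a coordinate, whose unit vector is the common point.\<close>
    obtain A where "I \<subseteq> A" "A \<subseteq> {..<s}" "card A = k"
      using exists_subset_between [of I k "{..<s}"] I \<open>k < s\<close> by auto
    moreover from this have "A \<in> range B"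
      using B by (simp add: bij_betw_def)
    then obtain j where "A = B j" by blast
    ultimately have "\<forall>i\<in>I. a \<le> l1_pairing (w i) (l1_unit j)"
      by (auto simp: w_def)
    then show ?thesis
      by (intro bexI [of _ "l1_unit j"]) auto
  qed
  have "a \<le> helly TYPE('n l1) k"
  proof (rule helly_l1_ge_balanced [of "{..<s}" w])
    show "\<bar>w i j\<bar> \<le> 1" for i j
      using \<open>k < s\<close> by (simp add: w_def a_def)
    show "(\<Sum>i<s. w i j) = 0" for j
    proof -
      have "(\<Sum>i<s. w i j) = real (card (B j)) * a - real (card ({..<s} - B j)) * (real k / real s)"
        using B_subset [of j]
        by (simp add: w_def sum.If_cases Int_absorb1 Diff_eq [symmetric])
      also have "card ({..<s} - B j) = s - k"
        using B_subset [of j] B_card [of j] by (simp add: card_Diff_subset finite_subset)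
      finally show ?thesis
        using \<open>k < s\<close> by (simp add: B_card a_def of_nat_diff field_simps)
    qed
    show "\<exists>v\<in>cball 0 1. a \<le> l1_pairing (w i) v" if "i \<in> {..<s}" for i
      \<comment> \<open>A singleton is small enough for \<open>meet\<close> because \<open>k\<close>
        is positive.\<close>
      using meet [of "{i}"] that False by auto
  qed (use meet \<open>k < s\<close> in auto)
  then show ?thesis by (simp add: a_def)
qed

theorem lemma10p1:
  fixes k s :: nat
  shows "(k < s \<longrightarrow> CARD('n::finite) = s choose k \<longrightarrow>
            helly TYPE('n l1) k \<ge> (real s - real k) / (real s + real k)) \<and>
         (CARD('m::finite) = (2 * k) choose k \<longrightarrow>
            helly TYPE('m l1) k \<ge> 1 / 3)"
proof (intro conjI impI)
  assume "k < s" "CARD('n) = s choose k"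
  then have "(real s - real k) / real s \<le> helly TYPE('n l1) k"
    by (rule helly_l1_binomial_ge)
  moreover have "(real s - real k) / (real s + real k) \<le> (real s - real k) / real s"
    using \<open>k < s\<close> by (intro divide_left_mono) auto
  ultimately show "(real s - real k) / (real s + real k) \<le> helly TYPE('n l1) k"
    by linarith
next
  assume card_m: "CARD('m) = (2 * k) choose k"
  show "1 / 3 \<le> helly TYPE('m l1) k"
  proof (cases "k = 0")
    case True
    then show ?thesis using helly_l1_0_ge [where 'n = 'm] by simp
  next
    case False
    \<comment> \<open>With \<open>s = 2 * k\<close> the stronger bound is 1/2; \<open>k < s\<close>
      holds only for positive \<open>k\<close>, hence the case split.\<close>
    then have "(real (2 * k) - real k) / real (2 * k) \<le> helly TYPE('m l1) k"
      using card_m by (intro helly_l1_binomial_ge) auto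
    then show ?thesis using False by simp
  qed
qed

end
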